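(* Consider, for $\theta\in[0,1]$, the inequality $$u(0)^2\le \mathrm{K}_1(\theta)\,\|u\|^{2\theta}\,\|\mathrm{D}u\|^{2(1-\theta)}\qquad\text{for all } u\in l^2(\mathbb{Z}),$$ with a finite constant $\mathrm{K}_1(\theta)$. This inequality holds only for $1/2\le\theta\le1$ (i.e. it holds with some finite constant if and only if $\theta\in[1/2,1]$). For $\theta\in[1/2,1]$ the sharp (smallest possible) constant is $$\mathrm{K}_1(\theta)=\frac12\left(\frac2\theta\right)^\theta(2\theta-1)^{\theta-1/2}.$$ For each $1/2<\theta\le1$ there exists a unique (up to a constant factor) extremal sequence, i.e. a nonzero $u\in l^2(\mathbb{Z})$ for which the inequality with the sharp constant becomes an equality.
   Context: Sequences are real-valued. For $u\in l^2(\mathbb{Z})$: $\mathrm{D}u(n)=u(n+1)-u(n)$, $\|u\|^2=\sum_{k\in\mathbb{Z}}u(k)^2$, $\|\mathrm{D}u\|^2=\sum_{k\in\mathbb{Z}}(\mathrm{D}u(k))^2$. Convention: $0^0=1$ (used in the formula at $\theta=1/2$, so that $\mathrm{K}_1(1/2)=1$, and for $\|\mathrm{D}u\|^{0}$). *)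

theory Defs
  imports "HOL-Analysis.Analysis"
begin

definition ell2 :: "(int \<Rightarrow> real) set" where
  "ell2 = {u. (\<lambda>k. (u k)\<^sup>2) summable_on UNIV}"

definition fdiff :: "(int \<Rightarrow> real) \<Rightarrow> int \<Rightarrow> real" where
  "fdiff u n = u (n + 1) - u n"

text \<open>
  Junk value \<open>0\<close> if \<open>u \<notin> ell2\<close>. Below, the norm is only applied to some \<open>u \<in> ell2\<close> and to
  \<open>fdiff u\<close>, which is then in \<open>ell2\<close> as well since \<open>(a - b)\<^sup>2 \<le> 2 * a\<^sup>2 + 2 * b\<^sup>2\<close>.
\<close>
definition ell2_norm :: "(int \<Rightarrow> real) \<Rightarrow> real" where
  "ell2_norm u = sqrt (\<Sum>\<^sub>\<infinity>k. (u k)\<^sup>2)"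

text \<open>
  Real powers of nonnegative reals with the convention \<open>0\<^sup>0 = 1\<close>; the library has \<open>0 powr 0 = 0\<close>.
\<close>
definition rpow :: "real \<Rightarrow> real \<Rightarrow> real" where
  "rpow x a = (if a = 0 then 1 else x powr a)"

definition interp_rhs :: "real \<Rightarrow> real \<Rightarrow> (int \<Rightarrow> real) \<Rightarrow> real" where
  "interp_rhs \<theta> C u =
     C * rpow (ell2_norm u) (2 * \<theta>) * rpow (ell2_norm (fdiff u)) (2 * (1 - \<theta>))"

definition interp_ineq :: "real \<Rightarrow> real \<Rightarrow> bool" where
  "interp_ineq \<theta> C \<longleftrightarrow> (\<forall>u\<in>ell2. (u 0)\<^sup>2 \<le> interp_rhs \<theta> C u)"

definition K1 :: "real \<Rightarrow> real" where
  "K1 \<theta> = 1 / 2 * rpow (2 / \<theta>) \<theta> * rpow (2 * \<theta> - 1) (\<theta> - 1 / 2)"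

definition extremal :: "real \<Rightarrow> (int \<Rightarrow> real) \<Rightarrow> bool" where
  "extremal \<theta> u \<longleftrightarrow>
     u \<in> ell2 \<and> u \<noteq> (\<lambda>_. 0) \<and> (u 0)\<^sup>2 = interp_rhs \<theta> (K1 \<theta>) u"

end

theory Submission
  imports Defs
begin

text \<open>
  Let \<open>A = \<parallel>u\<parallel>\<^sup>2\<close>, \<open>B = \<parallel>Du\<parallel>\<^sup>2\<close> and \<open>S u(n) = u(n + 1) + u(n)\<close>, so that \<open>\<parallel>Su\<parallel>\<^sup>2 = 4A - B\<close>.
  Since \<open>Du \<cdot> Su\<close> is the difference of \<open>u\<^sup>2\<close>, summing it to the left of \<open>0\<close> and subtracting the sum to
  the right gives \<open>2 u(0)\<^sup>2\<close>, and Cauchy--Schwarz yields \<open>4 u(0)\<^sup>4 \<le> B (4A - B)\<close>. Maximising the right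
  side against \<open>A\<^sup>2\<^sup>\<theta> B\<^sup>2\<^sup>-\<^sup>2\<^sup>\<theta>\<close> is weighted AM-GM and gives the constant. Equality in Cauchy--Schwarz forces
  \<open>Du = \<mp> t Su\<close> on the two sides of \<open>0\<close>, i.e. \<open>u(k) = u(0) ((1 - t) / (1 + t))\<^sup>|\<^sup>k\<^sup>|\<close>, and equality in
  AM-GM forces \<open>t\<^sup>2 = 2\<theta> - 1\<close>. For \<open>\<theta> \<le> 1/2\<close> let \<open>t \<rightarrow> 0\<close> in the same sequences.
\<close>

section \<open>Sums over the integers and square-summable sequences\<close>

lemma has_sum_shift_int: "((\<lambda>k::int. f (k + 1)) has_sum S) UNIV \<longleftrightarrow> (f has_sum S) UNIV"
proof (rule has_sum_reindex_bij_betw)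
  show "bij_betw (\<lambda>k::int. k + 1) UNIV UNIV"
    by (rule bij_betw_byWitness[where f' = "\<lambda>k. k - 1"]) auto
qed

text \<open>Splitting at 0 leaves two geometric series. Admitting \<open>r = 0\<close>, where
  \<open>0 ^ 0 = 1\<close>, later covers the case \<open>t = 1\<close>.\<close>

lemma has_sum_geometric_int:
  fixes r :: real
  assumes "0 \<le> r" "r < 1"
  shows "((\<lambda>k::int. r ^ nat \<bar>k\<bar>) has_sum ((1 + r) / (1 - r))) UNIV"
proof -
  have geo: "((\<lambda>n::nat. r ^ n) has_sum (1 / (1 - r))) UNIV"
    using assms by (intro sums_nonneg_imp_has_sum geometric_sums) auto
  have "((\<lambda>k. r ^ nat \<bar>k\<bar>) has_sum (1 / (1 - r))) {0::int..}"
    using geo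
    by (subst has_sum_reindex_bij_witness[where i = "int" and j = "nat" and T = "UNIV::nat set"
          and h = "\<lambda>n. r ^ n" and s' = "1 / (1 - r)"]) auto
  \<comment> \<open>The negative half starts at exponent 1, hence the extra factor
    \<open>r\<close>.\<close>
  moreover have "((\<lambda>k. r ^ nat \<bar>k\<bar>) has_sum (r * (1 / (1 - r)))) {..<0::int}"
    using has_sum_cmult_right[OF geo, of r]
    by (subst has_sum_reindex_bij_witness[where i = "\<lambda>n. - int n - 1" and j = "\<lambda>k. nat (- k - 1)"
          and T = "UNIV::nat set" and h = "\<lambda>n. r * r ^ n" and s' = "r * (1 / (1 - r))"])
       (auto simp flip: power_Suc intro!: arg_cong[where f = "\<lambda>n. r ^ n"])
  ultimately have "((\<lambda>k. r ^ nat \<bar>k\<bar>) has_sum (1 / (1 - r) + r * (1 / (1 - r)))) ({0..} \<union> {..<0::int})"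
    by (rule has_sum_Un_disjoint) auto
  moreover have "{0..} \<union> {..<0::int} = UNIV" by auto
  ultimately show ?thesis by (simp add: add_divide_distrib)
qed

lemma ell2I:
  assumes "((\<lambda>k. (u k)\<^sup>2) has_sum A) UNIV"
  shows "u \<in> ell2" "(ell2_norm u)\<^sup>2 = A"
proof -
  show "u \<in> ell2" using assms by (auto simp: ell2_def summable_on_def)
  have "0 \<le> A" using assms by (rule has_sum_nonneg) auto
  then show "(ell2_norm u)\<^sup>2 = A" using infsumI[OF assms] by (simp add: ell2_norm_def)
qed

lemma ell2_has_sum: "u \<in> ell2 \<Longrightarrow> ((\<lambda>k. (u k)\<^sup>2) has_sum (ell2_norm u)\<^sup>2) UNIV"
  by (metis ell2I(2) ell2_def has_sum_infsum mem_Collect_eq)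

lemma ell2_norm_nonneg [simp]: "0 \<le> ell2_norm u"
  by (simp add: ell2_norm_def infsum_nonneg)

text \<open>The parallelogram law for \<open>u (k + 1)\<close> and \<open>u k\<close>, summed over
  \<open>k\<close>; the shift does not change the norm.\<close>

lemma ell2_sum_fdiff:
  assumes "u \<in> ell2"
  shows "((\<lambda>k. (u (k + 1) + u k)\<^sup>2) has_sum (4 * (ell2_norm u)\<^sup>2 - (ell2_norm (fdiff u))\<^sup>2)) UNIV"
    and "((\<lambda>k. (fdiff u k)\<^sup>2) has_sum (ell2_norm (fdiff u))\<^sup>2) UNIV"
proof -
  let ?A = "(ell2_norm u)\<^sup>2"
  note a = ell2_has_sum[OF assms]
  have a1: "((\<lambda>k. (u (k + 1))\<^sup>2) has_sum ?A) UNIV"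
    using a has_sum_shift_int[of "\<lambda>k. (u k)\<^sup>2"] by simp
  have s: "((\<lambda>k. 2 * ((u (k + 1))\<^sup>2 + (u k)\<^sup>2)) has_sum (2 * (?A + ?A))) UNIV"
    by (intro has_sum_cmult_right has_sum_add a a1)
  have "(\<lambda>k. (fdiff u k)\<^sup>2) summable_on UNIV"
  proof (rule summable_on_comparison_test)
    show "(\<lambda>k. 2 * ((u (k + 1))\<^sup>2 + (u k)\<^sup>2)) summable_on UNIV"
      using s by (rule has_sum_imp_summable)
    show "(fdiff u k)\<^sup>2 \<le> 2 * ((u (k + 1))\<^sup>2 + (u k)\<^sup>2)" for k
      using zero_le_power2[of "u (k + 1) + u k"] by (simp add: fdiff_def power2_eq_square algebra_simps)
  qed auto
  then show d: "((\<lambda>k. (fdiff u k)\<^sup>2) has_sum (ell2_norm (fdiff u))\<^sup>2) UNIV"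
    by (intro ell2_has_sum) (simp add: ell2_def)
  have "((\<lambda>k. 2 * ((u (k + 1))\<^sup>2 + (u k)\<^sup>2) + (-1) * (fdiff u k)\<^sup>2) has_sum
      (2 * (?A + ?A) + (-1) * (ell2_norm (fdiff u))\<^sup>2)) UNIV"
    by (intro has_sum_add has_sum_cmult_right s d)
  then show "((\<lambda>k. (u (k + 1) + u k)\<^sup>2) has_sum (4 * ?A - (ell2_norm (fdiff u))\<^sup>2)) UNIV"
    by (simp add: fdiff_def power2_eq_square algebra_simps)
qed

section \<open>Telescoping and the Cauchy--Schwarz bound\<close>

text \<open>The index \<open>k\<close> stands for the edge from \<open>k\<close> to
  \<open>k + 1\<close>, so \<open>k < m\<close> singles out exactly the edges to the left of the
  point \<open>m\<close>.\<close>

definition side :: "int \<Rightarrow> int \<Rightarrow> real" where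
  "side m k = (if k < m then 1 else - 1)"

text \<open>The summand is \<open>side m k\<close> times the increment of the squares. Shifting its
  first half turns the sum into a difference of two signed sums of squares whose signs disagree only
  at \<open>m\<close>.\<close>

lemma side_telescope:
  assumes "u \<in> ell2"
  shows "((\<lambda>k. side m k * (fdiff u k * (u (k + 1) + u k))) has_sum 2 * (u m)\<^sup>2) UNIV"
proof -
  have summ: "(\<lambda>k. side n k * (u k)\<^sup>2) summable_on UNIV" for n
  proof (subst summable_on_iff_abs_summable_on_real)
    have "\<bar>side n k * (u k)\<^sup>2\<bar> = (u k)\<^sup>2" for k by (simp add: side_def abs_mult)
    then show "(\<lambda>k. norm (side n k * (u k)\<^sup>2)) summable_on UNIV"
      using assms by (simp add: ell2_def)
  qed
  obtain x y where x: "((\<lambda>k. side (m + 1) k * (u k)\<^sup>2) has_sum x) UNIV"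
    and y: "((\<lambda>k. side m k * (u k)\<^sup>2) has_sum y) UNIV"
    using summ by (meson summable_on_def)
  have "((\<lambda>k. side (m + 1) k * (u k)\<^sup>2 + (-1) * (side m k * (u k)\<^sup>2)) has_sum x + (-1) * y) UNIV"
    by (intro has_sum_add has_sum_cmult_right x y)
  moreover have "((\<lambda>k. side (m + 1) k * (u k)\<^sup>2 + (-1) * (side m k * (u k)\<^sup>2)) has_sum 2 * (u m)\<^sup>2) UNIV"
    by (rule has_sum_finite_neutralI[where B = "{m}"]) (auto simp: side_def)
  ultimately have xy: "x + (-1) * y = 2 * (u m)\<^sup>2" by (rule has_sum_unique)
  \<comment> \<open>Here \<open>side (m + 1) (k + 1)\<close> is \<open>side m k\<close>, so both
    sums now carry the same sign.\<close>
  have "((\<lambda>k. side (m + 1) (k + 1) * (u (k + 1))\<^sup>2) has_sum x) UNIV"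
    using x has_sum_shift_int[of "\<lambda>k. side (m + 1) k * (u k)\<^sup>2"] by simp
  from has_sum_add[OF this has_sum_cmult_right[OF y, of "-1"]]
  show ?thesis unfolding xy
    by (simp add: side_def fdiff_def power2_eq_square algebra_simps cong: if_cong)
qed

text \<open>Expanding the square leaves a quadratic in \<open>t\<close>. Its nonnegativity gives
  Cauchy--Schwarz, and its vanishing at one \<open>t\<close> characterises equality.\<close>

lemma quadratic_has_sum:
  assumes "u \<in> ell2"
  shows "((\<lambda>k. (side m k * fdiff u k - t * (u (k + 1) + u k))\<^sup>2) has_sum
    ((ell2_norm (fdiff u))\<^sup>2 - 4 * t * (u m)\<^sup>2
      + t\<^sup>2 * (4 * (ell2_norm u)\<^sup>2 - (ell2_norm (fdiff u))\<^sup>2))) UNIV"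
proof -
  have "((\<lambda>k. (fdiff u k)\<^sup>2 + (- 2 * t) * (side m k * (fdiff u k * (u (k + 1) + u k)))
        + t\<^sup>2 * (u (k + 1) + u k)\<^sup>2) has_sum
      ((ell2_norm (fdiff u))\<^sup>2 + (- 2 * t) * (2 * (u m)\<^sup>2)
        + t\<^sup>2 * (4 * (ell2_norm u)\<^sup>2 - (ell2_norm (fdiff u))\<^sup>2))) UNIV"
    by (intro has_sum_add has_sum_cmult_right side_telescope ell2_sum_fdiff assms)
  moreover have "(fdiff u k)\<^sup>2 + (- 2 * t) * (side m k * (fdiff u k * (u (k + 1) + u k)))
        + t\<^sup>2 * (u (k + 1) + u k)\<^sup>2 = (side m k * fdiff u k - t * (u (k + 1) + u k))\<^sup>2" for k
    by (simp add: side_def power2_eq_square algebra_simps)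
  ultimately show ?thesis by (simp add: mult.assoc)
qed

lemma pointwise_bound:
  assumes "u \<in> ell2"
  shows "4 * ((u m)\<^sup>2)\<^sup>2 \<le> (ell2_norm (fdiff u))\<^sup>2 * (4 * (ell2_norm u)\<^sup>2 - (ell2_norm (fdiff u))\<^sup>2)"
proof -
  define B P x where "B = (ell2_norm (fdiff u))\<^sup>2"
    and "P = 4 * (ell2_norm u)\<^sup>2 - (ell2_norm (fdiff u))\<^sup>2" and "x = (u m)\<^sup>2"
  have q: "0 \<le> B - 4 * t * x + t\<^sup>2 * P" for t
    unfolding B_def P_def x_def by (rule has_sum_nonneg[OF quadratic_has_sum[OF assms]]) simp
  have P: "0 \<le> P"
    unfolding P_def by (rule has_sum_nonneg[OF ell2_sum_fdiff(1)[OF assms]]) simp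
  have "4 * x\<^sup>2 \<le> B * P"
  proof (cases "P = 0")
    case True
    \<comment> \<open>For \<open>P = 0\<close> the quadratic is linear in \<open>t\<close>; if
      \<open>x\<close> were nonzero, this \<open>t\<close> would give it the value -1.\<close>
    have "x = 0"
      using q[of "(B + 1) / (4 * x)"] True by (cases "x = 0") auto
    then show ?thesis using True by simp
  next
    case False
    then have "0 < P" using P by simp
    \<comment> \<open>This \<open>t\<close> minimises the quadratic, with value
      \<open>B - 4 * x^2 / P\<close>.\<close>
    with q[of "2 * x / P"] show ?thesis
      by (simp add: field_simps power2_eq_square)
  qed
  then show ?thesis by (simp add: B_def P_def x_def)
qed

text \<open>The point \<open>m\<close> is arbitrary because extremals must be seen to have positive
  norms before \<open>u 0 \<noteq> 0\<close> is known.\<close>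

lemma norms_pos:
  assumes "u \<in> ell2" "u m \<noteq> 0"
  shows "0 < (ell2_norm u)\<^sup>2" "0 < (ell2_norm (fdiff u))\<^sup>2"
    "0 < 4 * (ell2_norm u)\<^sup>2 - (ell2_norm (fdiff u))\<^sup>2"
proof -
  let ?B = "(ell2_norm (fdiff u))\<^sup>2" and ?P = "4 * (ell2_norm u)\<^sup>2 - (ell2_norm (fdiff u))\<^sup>2"
  have "0 < 4 * ((u m)\<^sup>2)\<^sup>2" using assms by simp
  then have "0 < ?B * ?P" using pointwise_bound[OF assms(1), of m] by linarith
  then show "0 < ?B" "0 < ?P" by (auto simp: zero_less_mult_iff)
  then show "0 < (ell2_norm u)\<^sup>2" by linarith
qed

section \<open>Logarithmic form, weighted AM-GM and the upper bound\<close>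

lemma interp_rhs_exp:
  assumes "0 < (ell2_norm u)\<^sup>2" "0 < (ell2_norm (fdiff u))\<^sup>2"
  shows "interp_rhs \<theta> C u =
    C * exp (\<theta> * ln ((ell2_norm u)\<^sup>2) + (1 - \<theta>) * ln ((ell2_norm (fdiff u))\<^sup>2))"
proof -
  have rpow: "rpow x (2 * a) = exp (a * ln (x\<^sup>2))" if "0 < x" for x a
    using that by (simp add: rpow_def powr_def ln_realpow)
  have "0 < ell2_norm u" "0 < ell2_norm (fdiff u)"
    using assms by (simp_all add: less_le)
  then show ?thesis
    unfolding interp_rhs_def by (simp only: rpow exp_add mult.assoc)
qed

text \<open>At \<open>\<theta> = 1 / 2\<close> the factor \<open>\<theta> - 1 / 2\<close> removes the junk value \<open>ln 0\<close>.\<close>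
lemma K1_exp:
  assumes "1 / 2 \<le> \<theta>"
  shows "K1 \<theta> = exp (- ln 2 + \<theta> * (ln 2 - ln \<theta>) + (\<theta> - 1 / 2) * ln (2 * \<theta> - 1))"
proof -
  have "rpow (2 / \<theta>) \<theta> = exp (\<theta> * (ln 2 - ln \<theta>))"
    using assms by (simp add: rpow_def powr_def ln_div)
  moreover have "rpow (2 * \<theta> - 1) (\<theta> - 1 / 2) = exp ((\<theta> - 1 / 2) * ln (2 * \<theta> - 1))"
    using assms by (simp add: rpow_def powr_def)
  ultimately show ?thesis
    by (simp add: K1_def exp_add exp_diff)
qed

text \<open>This is concavity of \<open>ln\<close> at \<open>x / w\<close> and \<open>y\<close> with
  weights proportional to \<open>w\<close> and 1, proved from \<open>ln z \<le> z - 1\<close> after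
  dividing by the mean \<open>M\<close>. The inequality keeps \<open>w = 0\<close>, which
  corresponds to \<theta> = 1/2.\<close>

lemma weighted_am_gm_ln:
  fixes w x y :: real
  assumes "0 \<le> w" "0 < x" "0 < y"
  shows "w * ln x + ln y \<le> w * ln w + (1 + w) * ln ((x + y) / (1 + w))"
    and "\<lbrakk>0 < w; w * ln x + ln y = w * ln w + (1 + w) * ln ((x + y) / (1 + w))\<rbrakk> \<Longrightarrow> x = w * y"
proof -
  define M where "M = (x + y) / (1 + w)"
  have M: "0 < M" "(1 + w) * M = x + y" using assms by (simp_all add: M_def)
  have sum1: "x / M + y / M = 1 + w"
    using M by (simp add: field_simps)
  have ly: "ln y - ln M \<le> y / M - 1"
    using ln_le_minus_one[of "y / M"] assms M by (simp add: ln_div)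
  have lx: "w * ln x - w * ln w - w * ln M \<le> x / M - w"
  proof (cases "w = 0")
    case True then show ?thesis using assms M by simp
  next
    case False
    then have "ln (x / (w * M)) \<le> x / (w * M) - 1"
      using assms M by (intro ln_le_minus_one) simp
    then have "w * ln (x / (w * M)) \<le> w * (x / (w * M) - 1)"
      using assms by (simp add: mult_left_mono)
    then show ?thesis
      using False assms M by (simp add: ln_div ln_mult algebra_simps)
  qed
  have "w * ln x + ln y - (w * ln w + (1 + w) * ln M)
      = (w * ln x - w * ln w - w * ln M) + (ln y - ln M)" by (simp add: algebra_simps)
  with lx ly sum1 show "w * ln x + ln y \<le> w * ln w + (1 + w) * ln ((x + y) / (1 + w))"
    unfolding M_def[symmetric] by linarith
  assume "0 < w" and eq: "w * ln x + ln y = w * ln w + (1 + w) * ln ((x + y) / (1 + w))"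
  then have "ln y - ln M = y / M - 1"
    using lx ly sum1 unfolding M_def[symmetric] by (simp add: algebra_simps)
  \<comment> \<open>The bound \<open>ln z \<le> z - 1\<close> is tight only at
    \<open>z = 1\<close>.\<close>
  then have "y / M = 1"
    using assms M by (intro ln_eq_minus_one) (simp_all add: ln_div)
  then have "y = M" using M by simp
  then show "x = w * y" using M by (simp add: algebra_simps)
qed

text \<open>AM-GM with weight \<open>2 * \<theta> - 1\<close> is applied to \<open>B\<close> and
  \<open>P\<close>, whose sum \<open>4 * A\<close> is free of \<open>B\<close>. In the equality case
  both Cauchy--Schwarz and AM-GM must be tight.\<close>

lemma interp_K1:
  assumes u: "u \<in> ell2" "u 0 \<noteq> 0" and \<theta>: "1 / 2 \<le> \<theta>"
  shows "(u 0)\<^sup>2 \<le> interp_rhs \<theta> (K1 \<theta>) u"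
    and "\<lbrakk>1 / 2 < \<theta>; (u 0)\<^sup>2 = interp_rhs \<theta> (K1 \<theta>) u\<rbrakk> \<Longrightarrow>
      (ell2_norm (fdiff u))\<^sup>2 = (2 * \<theta> - 1) * (4 * (ell2_norm u)\<^sup>2 - (ell2_norm (fdiff u))\<^sup>2) \<and>
      4 * ((u 0)\<^sup>2)\<^sup>2 = (ell2_norm (fdiff u))\<^sup>2 * (4 * (ell2_norm u)\<^sup>2 - (ell2_norm (fdiff u))\<^sup>2)"
proof -
  define A B P where "A = (ell2_norm u)\<^sup>2" and "B = (ell2_norm (fdiff u))\<^sup>2" and "P = 4 * A - B"
  define w where "w = 2 * \<theta> - 1"
  define L E where "L = - ln 2 + \<theta> * (ln 2 - ln \<theta>) + (\<theta> - 1 / 2) * ln w + (\<theta> * ln A + (1 - \<theta>) * ln B)"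
    and "E = w * ln w + (1 + w) * (ln 2 + ln A - ln \<theta>)"
  have pos: "0 < A" "0 < B" "0 < P"
    using norms_pos[OF u] by (simp_all add: A_def B_def P_def)
  have w: "0 \<le> w" using \<theta> by (simp add: w_def)
  have x: "0 < (u 0)\<^sup>2" using u by simp
  have rhs: "interp_rhs \<theta> (K1 \<theta>) u = exp L"
    using interp_rhs_exp[of u \<theta> "K1 \<theta>"] pos K1_exp[OF \<theta>]
    by (simp add: L_def A_def B_def w_def flip: exp_add)
  have "(B + P) / (1 + w) = 2 * A / \<theta>" by (simp add: P_def w_def)
  then have "ln ((B + P) / (1 + w)) = ln 2 + ln A - ln \<theta>"
    using pos \<theta> by (simp add: ln_div ln_mult)
  note amgm = weighted_am_gm_ln[OF w pos(2,3), unfolded this, folded E_def]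
  have pb: "4 * ((u 0)\<^sup>2)\<^sup>2 \<le> B * P"
    using pointwise_bound[OF u(1)] by (simp add: A_def B_def P_def)
  have l4: "ln (4 * ((u 0)\<^sup>2)\<^sup>2) = 2 * ln 2 + 2 * ln ((u 0)\<^sup>2)"
    using x ln_realpow[of 2 2] ln_realpow[of "(u 0)\<^sup>2" 2] by (simp add: ln_mult)
  have lBP: "ln (B * P) = ln B + ln P" using pos by (simp add: ln_mult)
  have cs: "2 * ln 2 + 2 * ln ((u 0)\<^sup>2) \<le> ln B + ln P"
    unfolding l4[symmetric] lBP[symmetric] using pb x pos by simp
  \<comment> \<open>Thus \<open>2 * L\<close> is what remains when \<open>ln P\<close> in
    \<open>cs\<close> is replaced by its AM-GM bound \<open>E - w * ln B\<close>.\<close>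
  have split: "2 * L = - 2 * ln 2 + E - w * ln B + ln B"
    by (simp add: L_def E_def w_def algebra_simps)
  have "ln ((u 0)\<^sup>2) \<le> L"
    using cs split amgm(1) by linarith
  then show "(u 0)\<^sup>2 \<le> interp_rhs \<theta> (K1 \<theta>) u"
    unfolding rhs using x by (metis exp_le_cancel_iff exp_ln)
  assume "1 / 2 < \<theta>" and eq: "(u 0)\<^sup>2 = interp_rhs \<theta> (K1 \<theta>) u"
  have leq: "ln ((u 0)\<^sup>2) = L"
    unfolding eq rhs by simp
  have "B = w * P"
  proof (rule amgm(2))
    show "0 < w" using \<open>1 / 2 < \<theta>\<close> by (simp add: w_def)
    show "w * ln B + ln P = E"
      using cs split amgm(1) leq by linarith
  qed
  moreover have "ln (4 * ((u 0)\<^sup>2)\<^sup>2) = ln (B * P)"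
    unfolding l4 lBP using cs split amgm(1) leq by linarith
  then have "4 * ((u 0)\<^sup>2)\<^sup>2 = B * P"
    by (subst (asm) ln_inj_iff) (use x pos in simp_all)
  ultimately show "(ell2_norm (fdiff u))\<^sup>2 = (2 * \<theta> - 1) * (4 * (ell2_norm u)\<^sup>2 - (ell2_norm (fdiff u))\<^sup>2) \<and>
      4 * ((u 0)\<^sup>2)\<^sup>2 = (ell2_norm (fdiff u))\<^sup>2 * (4 * (ell2_norm u)\<^sup>2 - (ell2_norm (fdiff u))\<^sup>2)"
    by (simp add: A_def B_def P_def w_def)
qed

lemma K1_pos: "1 / 2 \<le> \<theta> \<Longrightarrow> 0 < K1 \<theta>"
  by (simp add: K1_exp)

lemma interp_ineq_K1:
  assumes "1 / 2 \<le> \<theta>"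
  shows "interp_ineq \<theta> (K1 \<theta>)"
  unfolding interp_ineq_def
proof
  fix u assume "u \<in> ell2"
  have "0 \<le> interp_rhs \<theta> (K1 \<theta>) u"
    using K1_pos[OF assms] by (simp add: interp_rhs_def rpow_def)
  with interp_K1(1)[OF \<open>u \<in> ell2\<close> _ assms] show "(u 0)\<^sup>2 \<le> interp_rhs \<theta> (K1 \<theta>) u"
    by (cases "u 0 = 0") auto
qed

section \<open>The two-sided geometric sequences\<close>

text \<open>At \<open>t = 1\<close> the ratio is 0 and \<open>0 ^ 0 = 1\<close> makes this the unit
  sequence at 0, the extremal for \<theta> = 1.\<close>

definition decay :: "real \<Rightarrow> int \<Rightarrow> real" where
  "decay t k = ((1 - t) / (1 + t)) ^ nat \<bar>k\<bar>"

lemma decay_0 [simp]: "decay t 0 = 1"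
  by (simp add: decay_def)

lemma decay_step:
  assumes "0 < t"
  shows "side 0 k * fdiff (decay t) k = t * (decay t (k + 1) + decay t k)"
proof -
  define q where "q = (1 - t) / (1 + t)"
  \<comment> \<open>The ratio \<open>q\<close> is chosen to solve
    \<open>1 - q = t * (1 + q)\<close>; \<open>x\<close> will be the larger power of the two
    neighbours.\<close>
  have q: "x - q * x = t * (x + q * x)" for x
    using assms by (simp add: q_def field_simps)
  show ?thesis
  proof (cases "k < 0")
    case True
    then have "nat \<bar>k\<bar> = Suc (nat \<bar>k + 1\<bar>)" by simp
    then show ?thesis
      using True q[of "q ^ nat \<bar>k + 1\<bar>"] by (simp add: side_def fdiff_def decay_def flip: q_def)
  next
    case False
    then have "nat \<bar>k + 1\<bar> = Suc (nat \<bar>k\<bar>)" by simp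
    then show ?thesis
      using False q[of "q ^ nat \<bar>k\<bar>"] by (simp add: side_def fdiff_def decay_def add.commute flip: q_def)
  qed
qed

text \<open>Only the norm of the sequence needs a geometric series. The norm of its difference
  follows from \<open>decay_step\<close> and the parallelogram law through
  \<open>B = t^2 * (4 * A - B)\<close>.\<close>

lemma decay_norms:
  assumes t: "0 < t" "t \<le> 1"
  shows "(\<lambda>k. c * decay t k) \<in> ell2"
    and "(ell2_norm (\<lambda>k. c * decay t k))\<^sup>2 = c\<^sup>2 * ((1 + t\<^sup>2) / (2 * t))"
    and "(ell2_norm (fdiff (\<lambda>k. c * decay t k)))\<^sup>2 = c\<^sup>2 * (2 * t)"
proof -
  define u where "u = (\<lambda>k. c * decay t k)"
  define q where "q = (1 - t) / (1 + t)"
  have q: "0 \<le> q" "q < 1" using t by (simp_all add: q_def)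
  have "1 + q\<^sup>2 = (2 * (1 + t\<^sup>2)) / (1 + t)\<^sup>2" "1 - q\<^sup>2 = (2 * (2 * t)) / (1 + t)\<^sup>2"
    using t by (simp_all add: q_def power_divide add_divide_eq_iff diff_divide_eq_iff divide_add_eq_iff
        divide_diff_eq_iff eq_divide_eq divide_eq_eq power2_eq_square) (simp_all add: algebra_simps)
  then have val: "(1 + q\<^sup>2) / (1 - q\<^sup>2) = (1 + t\<^sup>2) / (2 * t)"
    using t by simp (simp add: field_simps)
  have "((\<lambda>k. c\<^sup>2 * (q\<^sup>2) ^ nat \<bar>k\<bar>) has_sum (c\<^sup>2 * ((1 + q\<^sup>2) / (1 - q\<^sup>2)))) UNIV"
    using q by (intro has_sum_cmult_right has_sum_geometric_int) (simp_all add: power_less_one_iff abs_square_less_1)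
  then have "((\<lambda>k. (u k)\<^sup>2) has_sum (c\<^sup>2 * ((1 + t\<^sup>2) / (2 * t)))) UNIV"
    unfolding val by (simp add: u_def decay_def q_def power_mult_distrib power_even_eq mult.commute flip: power_mult)
  note u = ell2I[OF this]
  show "(\<lambda>k. c * decay t k) \<in> ell2"
    and "(ell2_norm (\<lambda>k. c * decay t k))\<^sup>2 = c\<^sup>2 * ((1 + t\<^sup>2) / (2 * t))"
    using u by (simp_all add: u_def)
  let ?A = "(ell2_norm u)\<^sup>2" and ?B = "(ell2_norm (fdiff u))\<^sup>2"
  have "(fdiff u k)\<^sup>2 = t\<^sup>2 * (u (k + 1) + u k)\<^sup>2" for k
  proof -
    have "(fdiff u k)\<^sup>2 = c\<^sup>2 * (side 0 k * fdiff (decay t) k)\<^sup>2"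
      by (simp add: u_def fdiff_def side_def power_mult_distrib flip: right_diff_distrib)
    also have "\<dots> = t\<^sup>2 * (u (k + 1) + u k)\<^sup>2"
      unfolding decay_step[OF t(1)] by (simp add: u_def power_mult_distrib flip: distrib_left)
    finally show ?thesis .
  qed
  then have "?B = t\<^sup>2 * (4 * ?A - ?B)"
    using ell2_sum_fdiff(2)[OF u(1)] has_sum_cmult_right[OF ell2_sum_fdiff(1)[OF u(1)], of "t\<^sup>2"]
    by (simp add: has_sum_unique)
  then have "(1 + t\<^sup>2) * ?B = t\<^sup>2 * 4 * ?A" by (simp add: algebra_simps)
  also have "\<dots> = (1 + t\<^sup>2) * (c\<^sup>2 * (2 * t))"
    unfolding u(2) using t by (simp add: field_simps power2_eq_square)
  finally have "?B = c\<^sup>2 * (2 * t)"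
    using add_pos_nonneg[of 1 "t\<^sup>2"] by simp
  then show "(ell2_norm (fdiff (\<lambda>k. c * decay t k)))\<^sup>2 = c\<^sup>2 * (2 * t)"
    by (simp add: u_def)
qed

text \<open>The factor \<open>2 * t\<close> enters with exponent -\<theta> from the first norm and 1
  - \<theta> from the second. The sign of the total, 1 - 2\<theta>, decides the behaviour as
  \<open>t\<close> tends to 0.\<close>

lemma interp_rhs_decay:
  assumes t: "0 < t" "t \<le> 1" and c: "c \<noteq> 0"
  shows "interp_rhs \<theta> C (\<lambda>k. c * decay t k) =
    C * (c\<^sup>2 * ((1 + t\<^sup>2) powr \<theta> * (2 * t) powr (1 - 2 * \<theta>)))"
proof -
  note norms = decay_norms[OF t]
  have p: "0 < 1 + t\<^sup>2" by (simp add: add_pos_nonneg)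
  have rhs: "c\<^sup>2 * ((1 + t\<^sup>2) powr \<theta> * (2 * t) powr (1 - 2 * \<theta>))
      = exp (ln (c\<^sup>2) + (\<theta> * ln (1 + t\<^sup>2) + (1 - 2 * \<theta>) * ln (2 * t)))"
    unfolding exp_add using c t p by (simp add: powr_def)
  have ln: "ln (c\<^sup>2 * ((1 + t\<^sup>2) / (2 * t))) = ln (c\<^sup>2) + ln (1 + t\<^sup>2) - ln (2 * t)"
    "ln (c\<^sup>2 * (2 * t)) = ln (c\<^sup>2) + ln (2 * t)"
    using c t p by (simp_all add: ln_mult ln_div)
  have pos: "0 < c\<^sup>2 * ((1 + t\<^sup>2) / (2 * t))" "0 < c\<^sup>2 * (2 * t)"
    using c t p by simp_all
  show ?thesis
    using interp_rhs_exp[of "\<lambda>k. c * decay t k" \<theta> C] pos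
    unfolding norms ln rhs by (simp add: ring_distribs left_diff_distrib)
qed

lemma extremal_decay:
  assumes \<theta>: "1 / 2 < \<theta>" "\<theta> \<le> 1" and c: "c \<noteq> 0"
  shows "extremal \<theta> (\<lambda>k. c * decay (sqrt (2 * \<theta> - 1)) k)"
proof -
  define t where "t = sqrt (2 * \<theta> - 1)"
  have t: "0 < t" "t \<le> 1" "t\<^sup>2 = 2 * \<theta> - 1" using \<theta> by (simp_all add: t_def)
  have lt: "ln (2 * \<theta> - 1) = 2 * ln t"
    using t ln_realpow[of t 2] by simp
  have "(1 + t\<^sup>2) powr \<theta> * (2 * t) powr (1 - 2 * \<theta>)
      = exp (\<theta> * (ln 2 + ln \<theta>) + (1 - 2 * \<theta>) * (ln 2 + ln t))"
    unfolding t(3) using \<theta> t(1) by (simp add: powr_def ln_mult exp_add)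
  \<comment> \<open>Since \<open>1 + t^2 = 2 * \<theta>\<close>, the constant is the reciprocal of
    the factor just computed.\<close>
  moreover have "K1 \<theta> = exp (- (\<theta> * (ln 2 + ln \<theta>) + (1 - 2 * \<theta>) * (ln 2 + ln t)))"
    using \<theta> by (simp add: K1_exp lt) (simp add: algebra_simps)
  ultimately have "K1 \<theta> * ((1 + t\<^sup>2) powr \<theta> * (2 * t) powr (1 - 2 * \<theta>)) = 1"
    by (simp only: exp_add[symmetric]) simp
  then have "interp_rhs \<theta> (K1 \<theta>) (\<lambda>k. c * decay t k) = c\<^sup>2"
    unfolding interp_rhs_decay[OF t(1,2) c] by (simp add: algebra_simps)
  moreover have "(\<lambda>k. c * decay t k) \<noteq> (\<lambda>_. 0)"
    using c by (metis decay_0 mult.right_neutral)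
  ultimately show ?thesis
    using decay_norms(1)[OF t(1,2)] by (simp add: extremal_def t_def)
qed

section \<open>Uniqueness of extremals\<close>

text \<open>On each side of 0 the relation is a first-order recurrence with ratio
  \<open>(1 - t) / (1 + t)\<close> in the outward direction.\<close>

lemma step_imp_decay:
  assumes t: "0 < t" and step: "\<And>k. side 0 k * fdiff v k = t * (v (k + 1) + v k)"
  shows "v k = v 0 * decay t k"
proof -
  have right: "v (int n) = v 0 * decay t (int n)" for n
  proof (induction n)
    case (Suc n)
    have "v (int n + 1) = (1 - t) / (1 + t) * v (int n)"
      using step[of "int n"] t by (simp add: side_def fdiff_def field_simps)
    with Suc show ?case by (simp add: decay_def nat_add_distrib add.commute)
  qed simp
  have left: "v (- int n) = v 0 * decay t (- int n)" for n
  proof (induction n)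
    case (Suc n)
    \<comment> \<open>The edge from \<open>- 1 - int n\<close> to \<open>- int n\<close> has sign
      1.\<close>
    have "v (- 1 - int n) = (1 - t) / (1 + t) * v (- int n)"
      using step[of "- 1 - int n"] t by (simp add: side_def fdiff_def field_simps)
    with Suc show ?case by (simp add: decay_def nat_add_distrib)
  qed simp
  show ?thesis
    using right[of "nat k"] left[of "nat (- k)"] by (cases "0 \<le> k") auto
qed

lemma extremal_imp_decay:
  assumes \<theta>: "1 / 2 < \<theta>" "\<theta> \<le> 1" and v: "extremal \<theta> v"
  shows "v 0 \<noteq> 0" "v k = v 0 * decay (sqrt (2 * \<theta> - 1)) k"
proof -
  have v2: "v \<in> ell2" and eq: "(v 0)\<^sup>2 = interp_rhs \<theta> (K1 \<theta>) v"
    using v by (simp_all add: extremal_def)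
  obtain m where "v m \<noteq> 0" using v by (auto simp: extremal_def)
  note pos = norms_pos[OF v2 this]
  have "0 < K1 \<theta>" using \<theta> by (simp add: K1_pos)
  \<comment> \<open>A nonzero value anywhere makes both norms, hence the right-hand side,
    positive.\<close>
  then have "0 < (v 0)\<^sup>2"
    unfolding eq interp_rhs_exp[OF pos(1,2)] by simp
  then show v0: "v 0 \<noteq> 0" by simp
  define t B P where "t = sqrt (2 * \<theta> - 1)" and "B = (ell2_norm (fdiff v))\<^sup>2"
    and "P = 4 * (ell2_norm v)\<^sup>2 - B"
  have t: "0 < t" "t\<^sup>2 = 2 * \<theta> - 1" using \<theta> by (simp_all add: t_def)
  have BP: "B = t\<^sup>2 * P" "4 * ((v 0)\<^sup>2)\<^sup>2 = B * P"
    using interp_K1(2)[OF v2 v0 _ \<theta>(1) eq] \<theta>(1) t by (simp_all add: B_def P_def)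
  then have "(2 * (v 0)\<^sup>2)\<^sup>2 = (t * P)\<^sup>2"
    by (simp add: power_mult_distrib power2_eq_square[of P])
  then have "2 * (v 0)\<^sup>2 = t * P"
    by (rule power2_eq_imp_eq) (use pos t in \<open>simp_all add: B_def P_def\<close>)
  \<comment> \<open>The three terms are \<open>t^2 * P\<close>, \<open>- 2 * t^2 * P\<close> and
    \<open>t^2 * P\<close>, so the sum of squares in \<open>quadratic_has_sum\<close> is 0.\<close>
  then have "B - 4 * t * (v 0)\<^sup>2 + t\<^sup>2 * P = 0"
    using BP(1) by (simp add: power2_eq_square)
  then have zero: "((\<lambda>k. (side 0 k * fdiff v k - t * (v (k + 1) + v k))\<^sup>2) has_sum 0) UNIV"
    using quadratic_has_sum[OF v2, of 0 t] by (simp add: B_def P_def)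
  have "(side 0 k * fdiff v k - t * (v (k + 1) + v k))\<^sup>2 = 0" for k
    using nonneg_has_sum_le_0D[OF zero, of k] by simp
  then show "v k = v 0 * decay (sqrt (2 * \<theta> - 1)) k"
    unfolding t_def[symmetric] by (intro step_imp_decay[OF t(1)]) simp
qed

section \<open>Necessity of \<theta> \<ge> 1/2 and sharpness of the constant\<close>

lemma interp_ineq_decay:
  assumes "interp_ineq \<theta> C" "0 < t" "t \<le> 1"
  shows "1 \<le> C * ((1 + t\<^sup>2) powr \<theta> * (2 * t) powr (1 - 2 * \<theta>))"
  using assms decay_norms(1)[OF assms(2,3), of 1] interp_rhs_decay[OF assms(2,3), of 1 \<theta> C]
  unfolding interp_ineq_def by force

lemma interp_ineq_limit:
  assumes C: "interp_ineq \<theta> C"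
    and lim: "((\<lambda>t. (1 + t\<^sup>2) powr \<theta> * (2 * t) powr (1 - 2 * \<theta>)) \<longlongrightarrow> l) (at_right (0::real))"
  shows "1 \<le> C * l"
proof (rule tendsto_lowerbound[OF tendsto_mult[OF tendsto_const lim]])
  have "\<forall>\<^sub>F t in at_right 0. t \<in> {0<..<1::real}"
    by (intro eventually_at_right_real) simp
  then show "\<forall>\<^sub>F t in at_right 0. 1 \<le> C * ((1 + t\<^sup>2) powr \<theta> * (2 * t) powr (1 - 2 * \<theta>))"
    by eventually_elim (intro interp_ineq_decay[OF C], auto)
qed simp

text \<open>Below 1/2 the power of \<open>2 * t\<close> has positive exponent, so the limit along
  the test sequences is 0 and no \<open>C\<close> survives.\<close>

lemma interp_ineq_imp_ge_half:
  assumes C: "interp_ineq \<theta> C"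
  shows "1 / 2 \<le> \<theta>"
proof (rule ccontr)
  assume "\<not> 1 / 2 \<le> \<theta>"
  then have "0 < 1 - 2 * \<theta>" by simp
  have "((\<lambda>t::real. (2 * t) powr (1 - 2 * \<theta>)) \<longlongrightarrow> 0 powr (1 - 2 * \<theta>)) (at_right 0)"
    using \<open>0 < 1 - 2 * \<theta>\<close>
    by (intro tendsto_powr') (auto intro!: tendsto_eq_intros simp: eventually_at_filter)
  moreover have "((\<lambda>t::real. (1 + t\<^sup>2) powr \<theta>) \<longlongrightarrow> 1) (at_right 0)"
    by (auto intro!: tendsto_eq_intros)
  ultimately have "((\<lambda>t. (1 + t\<^sup>2) powr \<theta> * (2 * t) powr (1 - 2 * \<theta>)) \<longlongrightarrow> 0) (at_right (0::real))"
    by (auto intro: tendsto_eq_intros)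
  from interp_ineq_limit[OF C this] show False by simp
qed

text \<open>For \<theta> > 1/2 the extremal itself is the test sequence. At 1/2 its parameter would
  be \<open>t = 0\<close>, a constant sequence outside \<open>ell2\<close>, so a limit is taken
  instead.\<close>

lemma K1_le:
  assumes C: "interp_ineq \<theta> C" and \<theta>: "1 / 2 \<le> \<theta>" "\<theta> \<le> 1"
  shows "K1 \<theta> \<le> C"
proof (cases "\<theta> = 1 / 2")
  case True
  have "((\<lambda>t::real. (1 + t\<^sup>2) powr \<theta> * (2 * t) powr (1 - 2 * \<theta>)) \<longlongrightarrow> 1) (at_right 0)"
  proof (rule Lim_transform_eventually)
    show "((\<lambda>t::real. (1 + t\<^sup>2) powr \<theta>) \<longlongrightarrow> 1) (at_right 0)"
      by (auto intro!: tendsto_eq_intros)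
    \<comment> \<open>Restricting to \<open>t > 0\<close> matters, since
      \<open>0 powr 0 = 0\<close>.\<close>
    show "\<forall>\<^sub>F t in at_right 0. (1 + t\<^sup>2) powr \<theta> = (1 + t\<^sup>2) powr \<theta> * (2 * t) powr (1 - 2 * \<theta>)"
      using eventually_at_right_less[of "0::real"] by eventually_elim (simp add: True)
  qed
  from interp_ineq_limit[OF C this] have "1 \<le> C" by simp
  moreover have "K1 \<theta> = 1" using powr_half_sqrt[of 4] by (simp add: True K1_def rpow_def)
  ultimately show ?thesis by simp
next
  case False
  define t where "t = sqrt (2 * \<theta> - 1)"
  define R where "R = (1 + t\<^sup>2) powr \<theta> * (2 * t) powr (1 - 2 * \<theta>)"
  have t: "0 < t" "t \<le> 1" using \<theta> False by (simp_all add: t_def)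
  have "extremal \<theta> (\<lambda>k. 1 * decay t k)"
    unfolding t_def using \<theta> False by (intro extremal_decay) auto
  then have "K1 \<theta> * R = 1"
    using interp_rhs_decay[OF t, of 1 \<theta> "K1 \<theta>"] by (simp add: extremal_def R_def)
  also have "1 \<le> C * R"
    using interp_ineq_decay[OF C t] by (simp add: R_def)
  finally have "K1 \<theta> * R \<le> C * R" .
  moreover have "0 < R"
    unfolding R_def using t add_pos_nonneg[of 1 "t\<^sup>2"] by simp
  ultimately show ?thesis by simp
qed

theorem theorem2p2:
  shows "(\<forall>\<theta>::real. 0 \<le> \<theta> \<and> \<theta> \<le> 1 \<longrightarrow>
            ((\<exists>C::real. interp_ineq \<theta> C) \<longleftrightarrow> 1 / 2 \<le> \<theta>))
       \<and> (\<forall>\<theta>::real. 1 / 2 \<le> \<theta> \<and> \<theta> \<le> 1 \<longrightarrow>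
            interp_ineq \<theta> (K1 \<theta>) \<and> (\<forall>C::real. interp_ineq \<theta> C \<longrightarrow> K1 \<theta> \<le> C))
       \<and> (\<forall>\<theta>::real. 1 / 2 < \<theta> \<and> \<theta> \<le> 1 \<longrightarrow>
            (\<exists>u. extremal \<theta> u \<and>
              (\<forall>v. extremal \<theta> v \<longleftrightarrow> (\<exists>c::real. c \<noteq> 0 \<and> v = (\<lambda>k. c * u k)))))"
proof (intro conjI allI impI)
  fix \<theta> :: real
  show "(\<exists>C. interp_ineq \<theta> C) \<longleftrightarrow> 1 / 2 \<le> \<theta>"
    using interp_ineq_K1 interp_ineq_imp_ge_half by blast
next
  fix \<theta> :: real assume "1 / 2 \<le> \<theta> \<and> \<theta> \<le> 1"
  then show "interp_ineq \<theta> (K1 \<theta>)" by (simp add: interp_ineq_K1)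
next
  fix \<theta> C :: real assume "1 / 2 \<le> \<theta> \<and> \<theta> \<le> 1" "interp_ineq \<theta> C"
  then show "K1 \<theta> \<le> C" by (simp add: K1_le)
next
  fix \<theta> :: real assume "1 / 2 < \<theta> \<and> \<theta> \<le> 1"
  then have \<theta>: "1 / 2 < \<theta>" "\<theta> \<le> 1" by auto
  let ?u = "decay (sqrt (2 * \<theta> - 1))"
  \<comment> \<open>In the forward direction the scalar is \<open>v 0\<close>.\<close>
  have "extremal \<theta> v \<longleftrightarrow> (\<exists>c. c \<noteq> 0 \<and> v = (\<lambda>k. c * ?u k))" for v
    using extremal_decay[OF \<theta>] extremal_imp_decay[OF \<theta>] by blast
  moreover have "extremal \<theta> ?u" using extremal_decay[OF \<theta>, of 1] by simp
  ultimately show "\<exists>u. extremal \<theta> u \<and>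
      (\<forall>v. extremal \<theta> v \<longleftrightarrow> (\<exists>c::real. c \<noteq> 0 \<and> v = (\<lambda>k. c * u k)))" by blast
qed

end
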